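(* Consider the multi-stage stochastic programming (MSSP) model described in the context. Let $r\in\mathcal R$ be an energy category with $\gamma_r=0$. Then the following inequalities are valid for the model, i.e. they are satisfied by every feasible solution of it: for every leaf node $n\in\mathcal N_l$, every $\underline q\in\mathcal Q$ and every $\overline q\in\{\underline q,\ldots,Q\}$, $$\eta^-_r\,\eta_r\sum_{s\in\mathcal S}\ \sum_{t\in\mathcal T'_{s,[\hat\kappa_{\underline q,T,n})}}\upsilon_{s,r,t,\hat\kappa_{\underline q,T,n}}\,x_{s,t,\mu_{t,n}}+\sum_{q=\underline q}^{\overline q}\ \sum_{j\in\mathcal J}\ \sum_{t\in\mathcal T'_{j,[T)}}\Gamma_{j,r,q,t,T,n}\,x_{j,t,\mu_{t,n}}+\sum_{q=\underline q}^{\overline q}\ \sum_{a\in\mathcal A}\ \sum_{t\in\mathcal T'_{a,[T)}}\varsigma_{a,r,t,T}\,x_{a,t,\mu_{t,n}}\ \ge\ \sum_{q=\underline q}^{\overline q}\delta_{r,q,T},$$ where, for $a\in\mathcal A$ and $t\in\mathcal T'_{a,[T)}$, $\varsigma_{a,r,t,T}=\varphi_a(1-\sigma_{a,t,T})$ if $r=\text{heat}$ and $\varsigma_{a,r,t,T}=0$ if $r=\text{electricity}$.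
   Context: **Sets and tree.** $\Psi$ is the finite set of stages. $\mathcal N=\{0,\ldots,N\}$ is the node set of a finite rooted scenario tree, with root the initialization node $0$, which has a single child (the stage-1 node). All leaves lie in the final stage, and $\mathcal N_l$ denotes the set of leaves. $\mathcal T=\{0,1,\ldots,T\}$ is the set of investment periods. Each node $n$ has a set $\mathcal T_n\subseteq\mathcal T$ of consecutive periods: $\mathcal T_0=\{0\}$, nodes of the same stage have the same $\mathcal T_n$, and along every root-to-leaf path the sets $\mathcal T_n$ partition $\mathcal T$ in increasing order (so $T\in\mathcal T_n$ for every leaf $n$). $\mathcal Q=\{1,\ldots,Q\}$ is the set of sub-periods in each period. $\mathcal R=\{\text{electricity},\text{heat}\}$. $\mathcal J,\mathcal S,\mathcal A$ are pairwise disjoint finite sets of generation, storage and heat-transfer technologies, and $\mathcal U=\mathcal J\cup\mathcal S\cup\mathcal A$. With $\tau_{u,t}$ the lifetime of technology $u$ installed in period $t$, $\mathcal T'_{u,[t')}=\{t\in\mathcal T: t\le t'<t+\tau_{u,t}\}$. For a node $n$ and a period $t$ not later than the last period of $n$, $\mu_{t,n}$ is the node on the path from node $0$ to $n$ (inclusive) whose period set contains $t$. $\kappa_{q,t,n}$ is the (sub-period, period, node) triple immediately preceding $(q,t,n)$: it is $(q-1,t,n)$ if $q\ge2$; $(Q,t-1,n)$ if $q=1$ and $t-1\in\mathcal T_n$; and $(Q,t-1,\text{parent of }n)$ if $q=1$ and $t-1\notin\mathcal T_n$. $\hat\kappa_{q,t,n}$ is the period component of $\kappa_{q,t,n}$ ($t$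 if $q\ge2$, $t-1$ if $q=1$). **Parameters** (real numbers): node probabilities $\pi_n$; discount factor $\beta>0$; installation costs $\alpha_{u,n}>0$; O&M costs $\hat\alpha_{u,t}\ge0$; purchase costs $\lambda_{r,t}\ge0$; demands $\delta_{r,q,t}\ge0$; generation $\Gamma_{j,r,q,t,t',n}\ge0$; storage capacities $\upsilon_{s,r,t,t'}\ge0$; heat-transfer capacities $\varphi_a\ge0$; degradation rates $\sigma_{u,t,t'}\in[0,1]$; charging/discharging efficiencies $\eta^+_r,\eta^-_r\in(0,1)$; self-discharge (retention) factor $\eta_r\in(0,1)$; coefficients of performance $\mathrm{cop}_{a,q,t,n}>0$; footprints $\rho_{u,t}\ge0$; initial installations $\iota_u\in\mathbb Z_+$; fractions $\gamma_r\ge0$; budgets $\phi_t\ge0$; areas $\varkappa_t\ge0$. Define $\mathbb 1_{a,r,q,t,t',n}=1-\sigma_{a,t,t'}$ if $r=\text{heat}$ and $\mathbb 1_{a,r,q,t,t',n}=-1/\mathrm{cop}_{a,q,t,n}$ if $r=\text{electricity}$. **MSSP model.** Variables: investments $x_{u,t,n}\in\mathbb Z_+$; operational variables $p_{r,q,t,n}$ (exogenous purchase), $h_{r,q,t,n}$ (stored energy), $h^+_{r,q,t,n}$ (charging), $h^-_{r,q,t,n}$ (discharging), $o_{r,q,t,n}$ (energy used from inventory and generation), $m_{a,q,t,t',n}$ (heat transferred in sub-period $q$ of period $t'\in\mathcal T_n$ by technology $a$ installed in period $t\in\mathcal T'_{a,[t')}$), all in $\mathbb R_+$. Minimize $$\sum_{n\in\mathcal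 N\setminus\{0\}}\sum_{t\in\mathcal T_n}\pi_n\beta^{t-1}\Big(\sum_{u\in\mathcal U}(\alpha_{u,n}+\hat\alpha_{u,t})x_{u,t,n}+\sum_{r\in\mathcal R}\sum_{q\in\mathcal Q}\lambda_{r,t}p_{r,q,t,n}\Big)$$ subject to: (1) $o_{r,q,t',n}+\sum_{a\in\mathcal A}\sum_{t\in\mathcal T'_{a,[t')}}\mathbb 1_{a,r,q,t,t',n}\,m_{a,q,t,t',n}\ge\delta_{r,q,t'}$ for $n\in\mathcal N\setminus\{0\}$, $t'\in\mathcal T_n$, $q\in\mathcal Q$, $r\in\mathcal R$; (2) $p_{r,q,t',n}-h^+_{r,q,t',n}+h^-_{r,q,t',n}+\sum_{j\in\mathcal J}\sum_{t\in\mathcal T'_{j,[t')}}\Gamma_{j,r,q,t,t',n}x_{j,t,\mu_{t,n}}\ge o_{r,q,t',n}$ for $n\in\mathcal N\setminus\{0\}$, $t'\in\mathcal T_n$, $q\in\mathcal Q$, $r\in\mathcal R$; (3) $h_{r,q,t',n}=\eta_r h_{r,\kappa_{q,t',n}}+\eta^+_r h^+_{r,q,t',n}-h^-_{r,q,t',n}/\eta^-_r$ for $n\in\mathcal N\setminus\{0\}$, $t'\in\mathcal T_n$, $q\in\mathcal Q$, $r\in\mathcal R$; (4) $h_{r,q,t',n}\le\sum_{s\in\mathcal S}\sum_{t\in\mathcal T'_{s,[t')}}\upsilon_{s,r,t,t'}x_{s,t,\mu_{t,n}}$ for $n\in\mathcal N$, $t'\in\mathcal T_n$, $q\in\mathcal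 Q$, $r\in\mathcal R$; (5) $m_{a,q,t,t',n}\le\varphi_a x_{a,t,\mu_{t,n}}$ for $n\in\mathcal N$, $t'\in\mathcal T_n$, $a\in\mathcal A$, $t\in\mathcal T'_{a,[t')}$, $q\in\mathcal Q$; (6) $\sum_{q\in\mathcal Q}p_{r,q,T,n}\le\gamma_r\sum_{q\in\mathcal Q}\delta_{r,q,T}$ for $n\in\mathcal N_l$, $r\in\mathcal R$; (7) $\sum_{u\in\mathcal U}\alpha_{u,n}x_{u,t,n}\le\phi_t$ for $n\in\mathcal N\setminus\{0\}$, $t\in\mathcal T_n$; (8) $\sum_{u\in\mathcal U}\sum_{t\in\mathcal T'_{u,[t')}}\rho_{u,t}x_{u,t,\mu_{t,n}}\le\varkappa_{t'}$ for $n\in\mathcal N\setminus\{0\}$, $t'\in\mathcal T_n$; (9) $x_{u,0,0}=\iota_u$ for $u\in\mathcal U$; (10) $x_{u,t,n}\le\lfloor\phi_t/\alpha_{u,n}\rfloor$ for $n\in\mathcal N$, $t\in\mathcal T_n$, $u\in\mathcal U$. *)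

theory Defs
  imports Complex_Main
begin

datatype energy = Electricity | Heat

text \<open>
  Data of the multi-stage stochastic programming (MSSP) model. Nodes are \<open>0, \<dots>, last_node\<close>,
  periods \<open>0, \<dots>, last_period\<close>, sub-periods \<open>1, \<dots>, num_subs\<close> and stages \<open>1, \<dots>, num_stages\<close>;
  the initialization node \<open>0\<close> precedes stage 1. The scenario tree is given by \<open>parent\<close>, whose
  value at the root is irrelevant. The comments give the mathematical symbols and the order of
  their indices.
\<close>

record 'u mssp =
  num_stages :: nat
  last_node :: nat
  parent :: "nat \<Rightarrow> nat"
  last_period :: nat
  node_periods :: "nat \<Rightarrow> nat set"  \<comment> \<open>\<open>\<T>\<^sub>n\<close>\<close>
  num_subs :: nat
  gen_techs :: "'u set"  \<comment> \<open>\<open>\<J>\<close>\<close>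
  stor_techs :: "'u set"  \<comment> \<open>\<open>\<S>\<close>\<close>
  heat_techs :: "'u set"  \<comment> \<open>\<open>\<A>\<close>\<close>
  lifetime :: "'u \<Rightarrow> nat \<Rightarrow> nat"  \<comment> \<open>\<open>\<tau>\<close> at \<open>u, t\<close>\<close>
  prob :: "nat \<Rightarrow> real"  \<comment> \<open>\<open>\<pi>\<close>\<close>
  discount :: real  \<comment> \<open>\<open>\<beta>\<close>\<close>
  inst_cost :: "'u \<Rightarrow> nat \<Rightarrow> real"  \<comment> \<open>\<open>\<alpha>\<close> at \<open>u, n\<close>\<close>
  om_cost :: "'u \<Rightarrow> nat \<Rightarrow> real"  \<comment> \<open>\<open>\<alpha>\<close>-hat at \<open>u, t\<close>\<close>
  purch_cost :: "energy \<Rightarrow> nat \<Rightarrow> real"  \<comment> \<open>\<open>\<lambda>\<close> at \<open>r, t\<close>\<close>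
  demand :: "energy \<Rightarrow> nat \<Rightarrow> nat \<Rightarrow> real"  \<comment> \<open>\<open>\<delta>\<close> at \<open>r, q, t\<close>\<close>
  gen_out :: "'u \<Rightarrow> energy \<Rightarrow> nat \<Rightarrow> nat \<Rightarrow> nat \<Rightarrow> nat \<Rightarrow> real"  \<comment> \<open>\<open>\<Gamma>\<close> at \<open>j, r, q, t, t', n\<close>\<close>
  stor_cap :: "'u \<Rightarrow> energy \<Rightarrow> nat \<Rightarrow> nat \<Rightarrow> real"  \<comment> \<open>\<open>\<upsilon>\<close> at \<open>s, r, t, t'\<close>\<close>
  heat_cap :: "'u \<Rightarrow> real"  \<comment> \<open>\<open>\<phi>\<close> (varphi) at \<open>a\<close>\<close>
  degr :: "'u \<Rightarrow> nat \<Rightarrow> nat \<Rightarrow> real"  \<comment> \<open>\<open>\<sigma>\<close> at \<open>u, t, t'\<close>\<close>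
  eff_charge :: "energy \<Rightarrow> real"  \<comment> \<open>\<open>\<eta>\<^sup>+\<close>\<close>
  eff_discharge :: "energy \<Rightarrow> real"  \<comment> \<open>\<open>\<eta>\<^sup>-\<close>\<close>
  retention :: "energy \<Rightarrow> real"  \<comment> \<open>\<open>\<eta>\<close>\<close>
  cop :: "'u \<Rightarrow> nat \<Rightarrow> nat \<Rightarrow> nat \<Rightarrow> real"  \<comment> \<open>at \<open>a, q, t, n\<close>\<close>
  footprint :: "'u \<Rightarrow> nat \<Rightarrow> real"  \<comment> \<open>\<open>\<rho>\<close> at \<open>u, t\<close>\<close>
  init_inst :: "'u \<Rightarrow> nat"  \<comment> \<open>\<open>\<iota>\<close>\<close>
  purch_frac :: "energy \<Rightarrow> real"  \<comment> \<open>\<open>\<gamma>\<close>\<close>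
  budget :: "nat \<Rightarrow> real"  \<comment> \<open>\<open>\<phi>\<close> (phi) at \<open>t\<close>\<close>
  area :: "nat \<Rightarrow> real"  \<comment> \<open>varkappa at \<open>t\<close>\<close>

definition nodes :: "'u mssp \<Rightarrow> nat set" where
  "nodes P = {0..last_node P}"

definition periods :: "'u mssp \<Rightarrow> nat set" where
  "periods P = {0..last_period P}"

definition subs :: "'u mssp \<Rightarrow> nat set" where
  "subs P = {1..num_subs P}"

definition techs :: "'u mssp \<Rightarrow> 'u set" where
  "techs P = gen_techs P \<union> stor_techs P \<union> heat_techs P"

definition leaves :: "'u mssp \<Rightarrow> nat set" where
  "leaves P = {n \<in> nodes P. \<not> (\<exists>c \<in> nodes P - {0}. parent P c = n)}"

definition stage :: "'u mssp \<Rightarrow> nat \<Rightarrow> nat" where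
  "stage P n = (LEAST k. (parent P ^^ k) n = 0)"

definition root_path :: "'u mssp \<Rightarrow> nat \<Rightarrow> nat set" where
  "root_path P n = {(parent P ^^ k) n | k. k \<le> stage P n}"

definition scenario_tree :: "'u mssp \<Rightarrow> bool" where
  "scenario_tree P \<longleftrightarrow>
     (\<forall>n \<in> nodes P - {0}. parent P n \<in> nodes P) \<and>
     (\<forall>n \<in> nodes P. \<exists>k. (parent P ^^ k) n = 0) \<and>
     (\<exists>!c. c \<in> nodes P - {0} \<and> parent P c = 0) \<and>
     (\<forall>n \<in> leaves P. stage P n = num_stages P)"

text \<open>The last conjunct yields disjointness of the period sets along a path as well as their order.\<close>

definition period_structure :: "'u mssp \<Rightarrow> bool" where
  "period_structure P \<longleftrightarrow>
     (\<forall>n \<in> nodes P. \<exists>t1 t2. t1 \<le> t2 \<and> t2 \<le> last_period P \<and> node_periods P n = {t1..t2}) \<and>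
     node_periods P 0 = {0} \<and>
     (\<forall>m \<in> nodes P. \<forall>n \<in> nodes P. stage P m = stage P n \<longrightarrow> node_periods P m = node_periods P n) \<and>
     (\<forall>l \<in> leaves P. (\<Union>n \<in> root_path P l. node_periods P n) = periods P) \<and>
     (\<forall>l \<in> leaves P. \<forall>m \<in> root_path P l. \<forall>n \<in> root_path P l. stage P m < stage P n \<longrightarrow>
        (\<forall>t \<in> node_periods P m. \<forall>t' \<in> node_periods P n. t < t'))"

text \<open>\<open>active P u t'\<close> is the set of installation periods of \<open>u\<close> still in operation in \<open>t'\<close>.\<close>

definition active :: "'u mssp \<Rightarrow> 'u \<Rightarrow> nat \<Rightarrow> nat set" where
  "active P u t' = {t \<in> periods P. t \<le> t' \<and> t' < t + lifetime P u t}"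

text \<open>\<open>node_at P t n\<close> is \<open>\<mu>\<close> at \<open>t, n\<close>; it is meaningful only if \<open>t\<close> is not later than the last period of \<open>n\<close>.\<close>

definition node_at :: "'u mssp \<Rightarrow> nat \<Rightarrow> nat \<Rightarrow> nat" where
  "node_at P t n = (THE m. m \<in> root_path P n \<and> t \<in> node_periods P m)"

text \<open>
  \<open>pred_triple\<close> is \<open>\<kappa>\<close>. It is only applied at nodes other than the root, whose periods are
  positive, so the subtraction \<open>t - 1\<close> does not truncate.
\<close>

definition pred_triple :: "'u mssp \<Rightarrow> nat \<Rightarrow> nat \<Rightarrow> nat \<Rightarrow> nat \<times> nat \<times> nat" where
  "pred_triple P q t n =
     (if q \<ge> 2 then (q - 1, t, n)
      else if t - 1 \<in> node_periods P n then (num_subs P, t - 1, n)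
      else (num_subs P, t - 1, parent P n))"

definition pred_period :: "'u mssp \<Rightarrow> nat \<Rightarrow> nat \<Rightarrow> nat \<Rightarrow> nat" where
  "pred_period P q t n = fst (snd (pred_triple P q t n))"

text \<open>The coefficient of performance is indexed by the installation period \<open>t\<close>, not by the period of use \<open>t'\<close>.\<close>

definition heat_coeff :: "'u mssp \<Rightarrow> 'u \<Rightarrow> energy \<Rightarrow> nat \<Rightarrow> nat \<Rightarrow> nat \<Rightarrow> nat \<Rightarrow> real" where
  "heat_coeff P a r q t t' n =
     (case r of Heat \<Rightarrow> 1 - degr P a t t' | Electricity \<Rightarrow> - 1 / cop P a q t n)"

text \<open>\<open>heat_cap_coeff\<close> is \<open>\<varsigma>\<close> at \<open>a, r, t, t'\<close>.\<close>

definition heat_cap_coeff :: "'u mssp \<Rightarrow> 'u \<Rightarrow> energy \<Rightarrow> nat \<Rightarrow> nat \<Rightarrow> real" where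
  "heat_cap_coeff P a r t t' =
     (case r of Heat \<Rightarrow> heat_cap P a * (1 - degr P a t t') | Electricity \<Rightarrow> 0)"

definition parameters_ok :: "'u mssp \<Rightarrow> bool" where
  "parameters_ok P \<longleftrightarrow>
     discount P > 0 \<and>
     (\<forall>u \<in> techs P. \<forall>n \<in> nodes P. inst_cost P u n > 0) \<and>
     (\<forall>u \<in> techs P. \<forall>t \<in> periods P. om_cost P u t \<ge> 0 \<and> footprint P u t \<ge> 0) \<and>
     (\<forall>r. \<forall>t \<in> periods P. purch_cost P r t \<ge> 0) \<and>
     (\<forall>r. \<forall>q \<in> subs P. \<forall>t \<in> periods P. demand P r q t \<ge> 0) \<and>
     (\<forall>j \<in> gen_techs P. \<forall>r. \<forall>q \<in> subs P. \<forall>n \<in> nodes P. \<forall>t' \<in> node_periods P n.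
        \<forall>t \<in> active P j t'. gen_out P j r q t t' n \<ge> 0) \<and>
     (\<forall>s \<in> stor_techs P. \<forall>r. \<forall>t' \<in> periods P. \<forall>t \<in> active P s t'. stor_cap P s r t t' \<ge> 0) \<and>
     (\<forall>a \<in> heat_techs P. heat_cap P a \<ge> 0) \<and>
     (\<forall>u \<in> techs P. \<forall>t' \<in> periods P. \<forall>t \<in> active P u t'. degr P u t t' \<in> {0..1}) \<and>
     (\<forall>r. eff_charge P r \<in> {0<..<1} \<and> eff_discharge P r \<in> {0<..<1} \<and> retention P r \<in> {0<..<1}) \<and>
     (\<forall>a \<in> heat_techs P. \<forall>q \<in> subs P. \<forall>n \<in> nodes P. \<forall>t' \<in> node_periods P n.
        \<forall>t \<in> active P a t'. cop P a q t n > 0) \<and>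
     (\<forall>r. purch_frac P r \<ge> 0) \<and>
     (\<forall>t \<in> periods P. budget P t \<ge> 0 \<and> area P t \<ge> 0)"

definition mssp_instance :: "'u mssp \<Rightarrow> bool" where
  "mssp_instance P \<longleftrightarrow>
     scenario_tree P \<and> period_structure P \<and>
     finite (gen_techs P) \<and> finite (stor_techs P) \<and> finite (heat_techs P) \<and>
     gen_techs P \<inter> stor_techs P = {} \<and> gen_techs P \<inter> heat_techs P = {} \<and>
     stor_techs P \<inter> heat_techs P = {} \<and>
     parameters_ok P"

record 'u mssp_vars =
  inv_var :: "'u \<Rightarrow> nat \<Rightarrow> nat \<Rightarrow> nat"  \<comment> \<open>\<open>x\<close> at \<open>u, t, n\<close>\<close>
  purch_var :: "energy \<Rightarrow> nat \<Rightarrow> nat \<Rightarrow> nat \<Rightarrow> real"  \<comment> \<open>\<open>p\<close> at \<open>r, q, t, n\<close>; likewise below\<close>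
  stored_var :: "energy \<Rightarrow> nat \<Rightarrow> nat \<Rightarrow> nat \<Rightarrow> real"  \<comment> \<open>\<open>h\<close>\<close>
  charge_var :: "energy \<Rightarrow> nat \<Rightarrow> nat \<Rightarrow> nat \<Rightarrow> real"  \<comment> \<open>\<open>h\<^sup>+\<close>\<close>
  discharge_var :: "energy \<Rightarrow> nat \<Rightarrow> nat \<Rightarrow> nat \<Rightarrow> real"  \<comment> \<open>\<open>h\<^sup>-\<close>\<close>
  used_var :: "energy \<Rightarrow> nat \<Rightarrow> nat \<Rightarrow> nat \<Rightarrow> real"  \<comment> \<open>\<open>o\<close>\<close>
  transfer_var :: "'u \<Rightarrow> nat \<Rightarrow> nat \<Rightarrow> nat \<Rightarrow> nat \<Rightarrow> real"  \<comment> \<open>\<open>m\<close> at \<open>a, q, t, t', n\<close>\<close>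

text \<open>The objective does not affect which inequalities are valid; it is given to complete the model.\<close>

definition objective :: "'u mssp \<Rightarrow> 'u mssp_vars \<Rightarrow> real" where
  "objective P X =
     (\<Sum>n \<in> nodes P - {0}. \<Sum>t \<in> node_periods P n. prob P n * discount P ^ (t - 1) *
        ((\<Sum>u \<in> techs P. (inst_cost P u n + om_cost P u t) * real (inv_var X u t n)) +
         (\<Sum>r \<in> UNIV. \<Sum>q \<in> subs P. purch_cost P r t * purch_var X r q t n)))"

definition nonneg_vars :: "'u mssp \<Rightarrow> 'u mssp_vars \<Rightarrow> bool" where
  "nonneg_vars P X \<longleftrightarrow>
     (\<forall>n \<in> nodes P. \<forall>t \<in> node_periods P n. \<forall>q \<in> subs P. \<forall>r.
        purch_var X r q t n \<ge> 0 \<and> stored_var X r q t n \<ge> 0 \<and> charge_var X r q t n \<ge> 0 \<and>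
        discharge_var X r q t n \<ge> 0 \<and> used_var X r q t n \<ge> 0) \<and>
     (\<forall>n \<in> nodes P. \<forall>t' \<in> node_periods P n. \<forall>q \<in> subs P. \<forall>a \<in> heat_techs P.
        \<forall>t \<in> active P a t'. transfer_var X a q t t' n \<ge> 0)"

definition demand_constr :: "'u mssp \<Rightarrow> 'u mssp_vars \<Rightarrow> bool" where
  "demand_constr P X \<longleftrightarrow>
     (\<forall>n \<in> nodes P - {0}. \<forall>t' \<in> node_periods P n. \<forall>q \<in> subs P. \<forall>r.
        used_var X r q t' n +
        (\<Sum>a \<in> heat_techs P. \<Sum>t \<in> active P a t'.
           heat_coeff P a r q t t' n * transfer_var X a q t t' n)
        \<ge> demand P r q t')"

definition supply_constr :: "'u mssp \<Rightarrow> 'u mssp_vars \<Rightarrow> bool" where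
  "supply_constr P X \<longleftrightarrow>
     (\<forall>n \<in> nodes P - {0}. \<forall>t' \<in> node_periods P n. \<forall>q \<in> subs P. \<forall>r.
        purch_var X r q t' n - charge_var X r q t' n + discharge_var X r q t' n +
        (\<Sum>j \<in> gen_techs P. \<Sum>t \<in> active P j t'.
           gen_out P j r q t t' n * real (inv_var X j t (node_at P t n)))
        \<ge> used_var X r q t' n)"

definition storage_balance :: "'u mssp \<Rightarrow> 'u mssp_vars \<Rightarrow> bool" where
  "storage_balance P X \<longleftrightarrow>
     (\<forall>n \<in> nodes P - {0}. \<forall>t' \<in> node_periods P n. \<forall>q \<in> subs P. \<forall>r.
        stored_var X r q t' n =
        retention P r *
          (case pred_triple P q t' n of (q0, t0, n0) \<Rightarrow> stored_var X r q0 t0 n0) +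
        eff_charge P r * charge_var X r q t' n -
        discharge_var X r q t' n / eff_discharge P r)"

definition storage_capacity :: "'u mssp \<Rightarrow> 'u mssp_vars \<Rightarrow> bool" where
  "storage_capacity P X \<longleftrightarrow>
     (\<forall>n \<in> nodes P. \<forall>t' \<in> node_periods P n. \<forall>q \<in> subs P. \<forall>r.
        stored_var X r q t' n \<le>
        (\<Sum>s \<in> stor_techs P. \<Sum>t \<in> active P s t'.
           stor_cap P s r t t' * real (inv_var X s t (node_at P t n))))"

definition transfer_capacity :: "'u mssp \<Rightarrow> 'u mssp_vars \<Rightarrow> bool" where
  "transfer_capacity P X \<longleftrightarrow>
     (\<forall>n \<in> nodes P. \<forall>t' \<in> node_periods P n. \<forall>a \<in> heat_techs P. \<forall>t \<in> active P a t'. \<forall>q \<in> subs P.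
        transfer_var X a q t t' n \<le> heat_cap P a * real (inv_var X a t (node_at P t n)))"

definition purchase_limit :: "'u mssp \<Rightarrow> 'u mssp_vars \<Rightarrow> bool" where
  "purchase_limit P X \<longleftrightarrow>
     (\<forall>n \<in> leaves P. \<forall>r.
        (\<Sum>q \<in> subs P. purch_var X r q (last_period P) n) \<le>
        purch_frac P r * (\<Sum>q \<in> subs P. demand P r q (last_period P)))"

definition budget_constr :: "'u mssp \<Rightarrow> 'u mssp_vars \<Rightarrow> bool" where
  "budget_constr P X \<longleftrightarrow>
     (\<forall>n \<in> nodes P - {0}. \<forall>t \<in> node_periods P n.
        (\<Sum>u \<in> techs P. inst_cost P u n * real (inv_var X u t n)) \<le> budget P t)"

definition area_constr :: "'u mssp \<Rightarrow> 'u mssp_vars \<Rightarrow> bool" where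
  "area_constr P X \<longleftrightarrow>
     (\<forall>n \<in> nodes P - {0}. \<forall>t' \<in> node_periods P n.
        (\<Sum>u \<in> techs P. \<Sum>t \<in> active P u t'.
           footprint P u t * real (inv_var X u t (node_at P t n))) \<le> area P t')"

definition initial_inst :: "'u mssp \<Rightarrow> 'u mssp_vars \<Rightarrow> bool" where
  "initial_inst P X \<longleftrightarrow> (\<forall>u \<in> techs P. inv_var X u 0 0 = init_inst P u)"

definition inv_bound :: "'u mssp \<Rightarrow> 'u mssp_vars \<Rightarrow> bool" where
  "inv_bound P X \<longleftrightarrow>
     (\<forall>n \<in> nodes P. \<forall>t \<in> node_periods P n. \<forall>u \<in> techs P.
        int (inv_var X u t n) \<le> \<lfloor>budget P t / inst_cost P u n\<rfloor>)"

definition feasible :: "'u mssp \<Rightarrow> 'u mssp_vars \<Rightarrow> bool" where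
  "feasible P X \<longleftrightarrow>
     nonneg_vars P X \<and> demand_constr P X \<and> supply_constr P X \<and> storage_balance P X \<and>
     storage_capacity P X \<and> transfer_capacity P X \<and> purchase_limit P X \<and>
     budget_constr P X \<and> area_constr P X \<and> initial_inst P X \<and> inv_bound P X"

end

theory Submission
  imports Defs
begin

text \<open>
  Fix a leaf \<open>n\<close> and let \<open>T\<close> be the last period. As \<open>\<gamma>\<^sub>r = 0\<close>, nothing is purchased at \<open>n\<close> in period
  \<open>T\<close>, so adding the demand and supply constraints bounds the demand of a sub-period by net
  discharge, generation and heat transfer. Generation needs no further estimate, and heat transfer is
  bounded by its installed capacity (\<open>heat_transfer_bound\<close>); for electricity it only consumes
  energy. For the net discharge, multiplying the storage balance by \<open>\<eta>\<^sup>-\<close> and using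
  \<open>\<eta>\<^sup>+ \<eta>\<^sup>- \<le> 1\<close> gives \<open>h\<^sup>-\<^sub>q - h\<^sup>+\<^sub>q \<le> \<eta>\<^sup>- (\<eta> h - h\<^sub>q)\<close>, where \<open>h\<close> is the preceding storage level.
  As levels are nonnegative and \<open>\<eta> \<le> 1\<close>, these bounds telescope to \<open>\<eta>\<^sup>- \<eta>\<close> times the level just before the first sub-period
  (\<open>net_discharge_bound\<close>).

  That level is bounded by the storage capacity of the preceding triple. The one delicate case is
  the first sub-period of a leaf whose only period is \<open>T\<close>: the capacity constraint then lives at
  the parent of \<open>n\<close>. The parent's periods contain \<open>T - 1\<close>, because the period sets partition
  \<open>{0..T}\<close> in increasing order along the path, and for earlier periods the parent and \<open>n\<close> have the
  same ancestor \<open>\<mu>\<close> (\<open>pred_stored_le_capacity\<close>).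
\<close>

section \<open>Paths in the scenario tree\<close>

lemma stage_root [simp]: "stage P 0 = 0"
  unfolding stage_def by (rule Least_eq_0) simp

lemma parent_node:
  assumes "scenario_tree P" "n \<in> nodes P" "n \<noteq> 0"
  shows "parent P n \<in> nodes P"
  using assms unfolding scenario_tree_def by simp

lemma stage_parent:
  assumes "scenario_tree P" "n \<in> nodes P" "n \<noteq> 0"
  shows "stage P n = Suc (stage P (parent P n))"
proof -
  obtain k where "(parent P ^^ k) n = 0"
    using assms unfolding scenario_tree_def by blast
  then have "(LEAST k. (parent P ^^ k) n = 0) = Suc (LEAST k. (parent P ^^ Suc k) n = 0)"
    by (rule Least_Suc) (use assms in simp)
  then show ?thesis
    unfolding stage_def by (simp add: funpow_swap1)
qed

lemma ancestor_node_stage: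
  assumes "scenario_tree P" "n \<in> nodes P" "k \<le> stage P n"
  shows "(parent P ^^ k) n \<in> nodes P \<and> stage P ((parent P ^^ k) n) + k = stage P n"
  using assms(3)
proof (induction k)
  case 0
  then show ?case using assms by simp
next
  case (Suc k)
  let ?m = "(parent P ^^ k) n"
  have m: "?m \<in> nodes P" "stage P ?m + k = stage P n"
    using Suc by auto
  then have "?m \<noteq> 0"
    using Suc.prems by (cases "?m = 0") auto
  moreover from this have "parent P ?m \<in> nodes P"
    by (rule parent_node[OF assms(1) m(1)])
  ultimately show ?case
    using stage_parent[OF assms(1) m(1)] m(2) by simp
qed

lemma root_path_self: "n \<in> root_path P n"
  unfolding root_path_def by (auto intro: exI[of _ 0])

lemma root_path_parent:
  assumes "scenario_tree P" "n \<in> nodes P" "n \<noteq> 0"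
  shows "root_path P n = insert n (root_path P (parent P n))"
proof -
  have "root_path P n = (\<lambda>k. (parent P ^^ k) n) ` {..Suc (stage P (parent P n))}"
    unfolding root_path_def stage_parent[OF assms] by auto
  also have "\<dots> = insert n ((\<lambda>k. (parent P ^^ Suc k) n) ` {..stage P (parent P n)})"
    unfolding atMost_Suc_eq_insert_0 by (simp add: image_image)
  also have "\<dots> = insert n (root_path P (parent P n))"
    unfolding root_path_def by (auto simp: funpow_swap1)
  finally show ?thesis .
qed

lemma root_path_stage_less:
  assumes "scenario_tree P" "n \<in> nodes P" "m \<in> root_path P n" "m \<noteq> n"
  shows "stage P m < stage P n"
proof -
  obtain k where k: "m = (parent P ^^ k) n" "k \<le> stage P n"
    using assms(3) unfolding root_path_def by auto
  moreover from k assms(4) have "k > 0" by (cases k) auto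
  ultimately show ?thesis
    using ancestor_node_stage[OF assms(1,2)] by fastforce
qed

lemma leaf_nonroot:
  assumes "scenario_tree P" "n \<in> leaves P"
  shows "n \<in> nodes P - {0}"
proof -
  obtain c where "c \<in> nodes P - {0}" "parent P c = 0"
    using assms(1) unfolding scenario_tree_def by (elim conjE ex1E)
  with assms(2) show ?thesis
    unfolding leaves_def by blast
qed

section \<open>Periods at a leaf\<close>

lemma node_periods_bounds:
  assumes "period_structure P" "n \<in> nodes P"
  obtains t1 t2 where "t1 \<le> t2" "t2 \<le> last_period P" "node_periods P n = {t1..t2}"
proof -
  have "\<exists>t1 t2. t1 \<le> t2 \<and> t2 \<le> last_period P \<and> node_periods P n = {t1..t2}"
    using assms unfolding period_structure_def by (elim conjE) (rule bspec)
  with that show ?thesis by blast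
qed

lemma node_periods_ordered:
  assumes "period_structure P" "l \<in> leaves P" "m \<in> root_path P l" "n \<in> root_path P l"
    "stage P m < stage P n" "t \<in> node_periods P m" "t' \<in> node_periods P n"
  shows "t < t'"
proof -
  have "\<forall>l \<in> leaves P. \<forall>m \<in> root_path P l. \<forall>n \<in> root_path P l. stage P m < stage P n \<longrightarrow>
      (\<forall>t \<in> node_periods P m. \<forall>t' \<in> node_periods P n. t < t')"
    using assms(1) unfolding period_structure_def by (elim conjE)
  with assms(2-7) show ?thesis by blast
qed

lemma period_on_root_path:
  assumes "period_structure P" "n \<in> leaves P" "t \<le> last_period P"
  obtains m where "m \<in> root_path P n" "t \<in> node_periods P m"
proof -
  have "(\<Union>m \<in> root_path P n. node_periods P m) = periods P"
    using assms(1,2) unfolding period_structure_def by blast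
  then have "t \<in> (\<Union>m \<in> root_path P n. node_periods P m)"
    using assms(3) by (simp add: periods_def)
  with that show ?thesis by blast
qed

lemma last_period_leaf:
  assumes "scenario_tree P" "period_structure P" "n \<in> leaves P"
  shows "last_period P \<in> node_periods P n"
proof -
  have n: "n \<in> nodes P" using leaf_nonroot[OF assms(1,3)] by simp
  obtain m where m: "m \<in> root_path P n" "last_period P \<in> node_periods P m"
    using period_on_root_path[OF assms(2,3)] by blast
  obtain t1 t2 where t: "t1 \<le> t2" "t2 \<le> last_period P" "node_periods P n = {t1..t2}"
    using node_periods_bounds[OF assms(2) n] .
  have "m = n"
  proof (rule ccontr)
    assume "m \<noteq> n"
    then have "last_period P < t2"
      using node_periods_ordered[OF assms(2,3) m(1) root_path_self _ m(2), of t2]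
        root_path_stage_less[OF assms(1) n m(1)] t by auto
    with t show False by simp
  qed
  with m show ?thesis by simp
qed

lemma prev_period_parent:
  assumes "scenario_tree P" "period_structure P" "n \<in> leaves P"
    and "last_period P - 1 \<notin> node_periods P n"
  shows "last_period P - 1 \<in> node_periods P (parent P n)"
proof -
  let ?T = "last_period P" and ?p = "parent P n"
  have n: "n \<in> nodes P" "n \<noteq> 0" using leaf_nonroot[OF assms(1,3)] by auto
  have p: "?p \<in> nodes P" by (rule parent_node[OF assms(1) n])
  note path = root_path_parent[OF assms(1) n]
  have p_path: "?p \<in> root_path P n" using path root_path_self by blast
  obtain m where m: "m \<in> root_path P n" "?T - 1 \<in> node_periods P m"
    using period_on_root_path[OF assms(2,3), of "?T - 1"] by auto
  with assms(4) path have m_path: "m \<in> root_path P ?p" by auto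
  obtain t1 t2 where t: "t1 \<le> t2" "node_periods P ?p = {t1..t2}"
    using node_periods_bounds[OF assms(2) p] .
  have "m = ?p"
  proof (rule ccontr)
    \<comment> \<open>A period of the parent would lie strictly between \<open>T - 1\<close> and \<open>T\<close>.\<close>
    assume "m \<noteq> ?p"
    then have "?T - 1 < t2"
      using node_periods_ordered[OF assms(2,3) m(1) p_path _ m(2), of t2]
        root_path_stage_less[OF assms(1) p m_path] t by auto
    moreover have "t2 < ?T"
      using node_periods_ordered[OF assms(2,3) p_path root_path_self, of t2 ?T]
        stage_parent[OF assms(1) n] last_period_leaf[OF assms(1-3)] t by auto
    ultimately show False by simp
  qed
  with m show ?thesis by simp
qed

text \<open>The root paths of a node and of its parent differ only in the node itself, so the descriptions
  defining \<open>\<mu>\<close> at the two nodes coincide for a period outside the node; neither has to be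
  satisfiable.\<close>

lemma node_at_parent:
  assumes "scenario_tree P" "n \<in> nodes P" "n \<noteq> 0" "t \<notin> node_periods P n"
  shows "node_at P t (parent P n) = node_at P t n"
proof -
  have "(\<lambda>m. m \<in> root_path P (parent P n) \<and> t \<in> node_periods P m) =
      (\<lambda>m. m \<in> root_path P n \<and> t \<in> node_periods P m)"
    using assms(4) unfolding root_path_parent[OF assms(1-3)] by auto
  then show ?thesis
    unfolding node_at_def by simp
qed

section \<open>Storage\<close>

text \<open>The storage level \<open>h\<close> at the preceding triple \<open>\<kappa>\<close>, as it occurs in the storage balance.\<close>

definition pred_stored :: "'u mssp \<Rightarrow> 'u mssp_vars \<Rightarrow> energy \<Rightarrow> nat \<Rightarrow> nat \<Rightarrow> nat \<Rightarrow> real" where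
  "pred_stored P X r q t n = (case pred_triple P q t n of (q0, t0, n0) \<Rightarrow> stored_var X r q0 t0 n0)"

text \<open>
  The storage level preceding a sub-period of the last period at a leaf is bounded by the capacity in
  the preceding period, with installations looked up from the leaf even if that period belongs to
  the parent.
\<close>

lemma pred_stored_le_capacity:
  assumes "scenario_tree P" "period_structure P" "storage_capacity P X"
    and "n \<in> leaves P" "q \<in> subs P"
  defines "t' \<equiv> pred_period P q (last_period P) n"
  shows "pred_stored P X r q (last_period P) n \<le>
    (\<Sum>s \<in> stor_techs P. \<Sum>t \<in> active P s t'.
       stor_cap P s r t t' * real (inv_var X s t (node_at P t n)))"
proof -
  let ?T = "last_period P"
  have n: "n \<in> nodes P" "n \<noteq> 0" using leaf_nonroot[OF assms(1,4)] by auto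
  have T: "?T \<in> node_periods P n" by (rule last_period_leaf[OF assms(1,2,4)])
  have cap: "stored_var X r q0 t0 m \<le> (\<Sum>s \<in> stor_techs P. \<Sum>t \<in> active P s t0.
       stor_cap P s r t t0 * real (inv_var X s t (node_at P t m)))"
    if "m \<in> nodes P" "t0 \<in> node_periods P m" "q0 \<in> subs P" for q0 t0 m
    using assms(3) that unfolding storage_capacity_def by blast
  have Q: "num_subs P \<in> subs P" using assms(5) unfolding subs_def by simp
  consider "q \<ge> 2" | "q < 2" "?T - 1 \<in> node_periods P n" | "q < 2" "?T - 1 \<notin> node_periods P n"
    by linarith
  then show ?thesis
  proof cases
    case 1
    then have "q - 1 \<in> subs P" using assms(5) unfolding subs_def by auto
    then show ?thesis
      using 1 cap[OF n(1) T] unfolding t'_def pred_stored_def pred_period_def pred_triple_def by simp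
  next
    case 2
    then show ?thesis
      using cap[OF n(1) _ Q] unfolding t'_def pred_stored_def pred_period_def pred_triple_def by simp
  next
    case 3
    have p: "parent P n \<in> nodes P"
      by (rule parent_node[OF assms(1) n])
    have same_node: "node_at P t (parent P n) = node_at P t n" if "t \<le> ?T - 1" for t
    proof (rule node_at_parent[OF assms(1) n])
      obtain t1 t2 where per: "node_periods P n = {t1..t2}"
        using node_periods_bounds[OF assms(2) n(1)] .
      \<comment> \<open>The periods of \<open>n\<close> are consecutive and contain \<open>T\<close> but not \<open>T - 1\<close>.\<close>
      show "t \<notin> node_periods P n"
        using that T 3(2) unfolding per by auto
    qed
    have "stored_var X r (num_subs P) (?T - 1) (parent P n) \<le>
        (\<Sum>s \<in> stor_techs P. \<Sum>t \<in> active P s (?T - 1).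
          stor_cap P s r t (?T - 1) * real (inv_var X s t (node_at P t (parent P n))))"
      by (rule cap[OF p prev_period_parent[OF assms(1,2,4) 3(2)] Q])
    also have "\<dots> = (\<Sum>s \<in> stor_techs P. \<Sum>t \<in> active P s (?T - 1).
          stor_cap P s r t (?T - 1) * real (inv_var X s t (node_at P t n)))"
      by (intro sum.cong refl) (simp add: same_node active_def)
    finally show ?thesis
      using 3 unfolding t'_def pred_stored_def pred_period_def pred_triple_def by simp
  qed
qed

lemma net_discharge_step:
  assumes "parameters_ok P" "nonneg_vars P X" "storage_balance P X"
    and "n \<in> nodes P - {0}" "t \<in> node_periods P n" "q \<in> subs P"
  shows "discharge_var X r q t n - charge_var X r q t n \<le>
    eff_discharge P r * (retention P r * pred_stored P X r q t n - stored_var X r q t n)"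
proof -
  have eff: "0 < eff_discharge P r" "eff_discharge P r < 1" "0 < eff_charge P r" "eff_charge P r < 1"
    using assms(1) unfolding parameters_ok_def by auto
  have bal: "stored_var X r q t n = retention P r * pred_stored P X r q t n +
      eff_charge P r * charge_var X r q t n - discharge_var X r q t n / eff_discharge P r"
    using assms(3-6) unfolding storage_balance_def pred_stored_def by blast
  have "eff_discharge P r * (discharge_var X r q t n / eff_discharge P r) = discharge_var X r q t n"
    using eff by simp
  then have dis: "discharge_var X r q t n =
      eff_discharge P r * (retention P r * pred_stored P X r q t n - stored_var X r q t n) +
      eff_discharge P r * eff_charge P r * charge_var X r q t n"
    unfolding bal by (simp add: algebra_simps)
  have "0 \<le> charge_var X r q t n"
    using assms(2,4-6) unfolding nonneg_vars_def by blast
  moreover have "eff_discharge P r * eff_charge P r \<le> 1"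
    using eff by (simp add: mult_le_one)
  ultimately have "eff_discharge P r * eff_charge P r * charge_var X r q t n \<le> charge_var X r q t n"
    using eff by (intro mult_left_le_one_le) simp_all
  with dis show ?thesis by linarith
qed

text \<open>
  The final storage level is kept on the right-hand side; it pays for the next sub-period in the
  induction.
\<close>

lemma net_discharge_bound:
  assumes "parameters_ok P" "nonneg_vars P X" "storage_balance P X"
    and "n \<in> nodes P - {0}" "t \<in> node_periods P n" "1 \<le> ql" "ql \<le> qu" "qu \<le> num_subs P"
  shows "(\<Sum>q = ql..qu. discharge_var X r q t n - charge_var X r q t n) \<le>
    eff_discharge P r * (retention P r * pred_stored P X r ql t n - stored_var X r qu t n)"
  using assms(7,8)
proof (induction qu rule: dec_induct)
  case base
  then show ?case
    using net_discharge_step[OF assms(1-5), of ql r] assms(6) unfolding subs_def by simp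
next
  case (step q)
  have eff: "0 < eff_discharge P r" "0 < retention P r" "retention P r < 1"
    using assms(1) unfolding parameters_ok_def by auto
  have q: "q \<in> subs P" "Suc q \<in> subs P"
    using step assms(6) unfolding subs_def by auto
  have "0 \<le> stored_var X r q t n"
    using assms(2,4,5) q(1) unfolding nonneg_vars_def by blast
  then have decay: "retention P r * stored_var X r q t n \<le> stored_var X r q t n"
    using eff by (simp add: mult_left_le_one_le)
  have pred: "pred_stored P X r (Suc q) t n = stored_var X r q t n"
    using step assms(6) unfolding pred_stored_def pred_triple_def by simp
  have "(\<Sum>q = ql..Suc q. discharge_var X r q t n - charge_var X r q t n) \<le>
      eff_discharge P r * (retention P r * pred_stored P X r ql t n - stored_var X r q t n) +
      eff_discharge P r * (retention P r * stored_var X r q t n - stored_var X r (Suc q) t n)"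
    using step net_discharge_step[OF assms(1-5) q(2), of r] unfolding pred by simp
  also have "\<dots> = eff_discharge P r * (retention P r * pred_stored P X r ql t n -
      stored_var X r q t n + retention P r * stored_var X r q t n - stored_var X r (Suc q) t n)"
    by (simp add: algebra_simps)
  also have "\<dots> \<le> eff_discharge P r *
      (retention P r * pred_stored P X r ql t n - stored_var X r (Suc q) t n)"
    using eff decay by (intro mult_left_mono) auto
  finally show ?case .
qed

section \<open>Purchases and heat transfer\<close>

lemma no_purchase:
  assumes "nonneg_vars P X" "purchase_limit P X" "purch_frac P r = 0"
    and "n \<in> leaves P" "last_period P \<in> node_periods P n" "q \<in> subs P"
  shows "purch_var X r q (last_period P) n = 0"
proof -
  have n: "n \<in> nodes P" using assms(4) unfolding leaves_def by simp
  have nonneg: "0 \<le> purch_var X r q' (last_period P) n" if "q' \<in> subs P" for q'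
    using assms(1,5) n that unfolding nonneg_vars_def by blast
  have "(\<Sum>q' \<in> subs P. purch_var X r q' (last_period P) n) \<le> 0"
    using assms(2-4) unfolding purchase_limit_def by (metis mult_zero_left)
  then have "(\<Sum>q' \<in> subs P. purch_var X r q' (last_period P) n) = 0"
    using nonneg by (intro antisym sum_nonneg) auto
  then show ?thesis
    using nonneg assms(6) by (subst (asm) sum_nonneg_eq_0_iff) (auto simp: subs_def)
qed

lemma heat_transfer_bound:
  assumes "parameters_ok P" "nonneg_vars P X" "transfer_capacity P X"
    and "n \<in> nodes P" "t' \<in> node_periods P n" "t' \<in> periods P" "q \<in> subs P"
    and "a \<in> heat_techs P" "t \<in> active P a t'"
  shows "heat_coeff P a r q t t' n * transfer_var X a q t t' n \<le>
    heat_cap_coeff P a r t t' * real (inv_var X a t (node_at P t n))"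
proof (cases r)
  case Heat
  have "a \<in> techs P" using assms(8) unfolding techs_def by simp
  then have "degr P a t t' \<in> {0..1}"
    using assms(1,6,9) unfolding parameters_ok_def by blast
  moreover have "transfer_var X a q t t' n \<le> heat_cap P a * real (inv_var X a t (node_at P t n))"
    using assms(3-5,7-9) unfolding transfer_capacity_def by blast
  ultimately have "(1 - degr P a t t') * transfer_var X a q t t' n \<le>
      (1 - degr P a t t') * (heat_cap P a * real (inv_var X a t (node_at P t n)))"
    by (intro mult_left_mono) auto
  with Heat show ?thesis
    unfolding heat_coeff_def heat_cap_coeff_def by (simp add: ac_simps)
next
  case Electricity
  have "0 < cop P a q t n"
    using assms(1,4,5,7-9) unfolding parameters_ok_def by blast
  moreover have "0 \<le> transfer_var X a q t t' n"
    using assms(2,4,5,7-9) unfolding nonneg_vars_def by blast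
  ultimately show ?thesis
    using Electricity unfolding heat_coeff_def heat_cap_coeff_def by simp
qed

section \<open>The valid inequalities\<close>

theorem proposition1:
  fixes P :: "'u mssp" and X :: "'u mssp_vars" and r :: energy and n ql qu :: nat
  assumes "mssp_instance P"
    and "purch_frac P r = 0"
    and "feasible P X"
    and "n \<in> leaves P"
    and "ql \<in> subs P"
    and "qu \<in> {ql..num_subs P}"
  shows "eff_discharge P r * retention P r *
      (\<Sum>s \<in> stor_techs P. \<Sum>t \<in> active P s (pred_period P ql (last_period P) n).
         stor_cap P s r t (pred_period P ql (last_period P) n) * real (inv_var X s t (node_at P t n)))
    + (\<Sum>q = ql..qu. \<Sum>j \<in> gen_techs P. \<Sum>t \<in> active P j (last_period P).
         gen_out P j r q t (last_period P) n * real (inv_var X j t (node_at P t n)))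
    + (\<Sum>q = ql..qu. \<Sum>a \<in> heat_techs P. \<Sum>t \<in> active P a (last_period P).
         heat_cap_coeff P a r t (last_period P) * real (inv_var X a t (node_at P t n)))
    \<ge> (\<Sum>q = ql..qu. demand P r q (last_period P))"
proof -
  let ?T = "last_period P"
  let ?cap = "\<Sum>s \<in> stor_techs P. \<Sum>t \<in> active P s (pred_period P ql ?T n).
    stor_cap P s r t (pred_period P ql ?T n) * real (inv_var X s t (node_at P t n))"
  let ?gen = "\<lambda>q. \<Sum>j \<in> gen_techs P. \<Sum>t \<in> active P j ?T.
    gen_out P j r q t ?T n * real (inv_var X j t (node_at P t n))"
  let ?heat = "\<Sum>a \<in> heat_techs P. \<Sum>t \<in> active P a ?T.
    heat_cap_coeff P a r t ?T * real (inv_var X a t (node_at P t n))"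
  let ?net = "\<lambda>q. discharge_var X r q ?T n - charge_var X r q ?T n"
  have inst: "scenario_tree P" "period_structure P" "parameters_ok P"
    using assms(1) unfolding mssp_instance_def by auto
  have feas: "nonneg_vars P X" "demand_constr P X" "supply_constr P X" "storage_balance P X"
    "storage_capacity P X" "transfer_capacity P X" "purchase_limit P X"
    using assms(3) unfolding feasible_def by auto
  have n: "n \<in> nodes P - {0}" by (rule leaf_nonroot[OF inst(1) assms(4)])
  have T: "?T \<in> node_periods P n" by (rule last_period_leaf[OF inst(1,2) assms(4)])
  have bounds: "1 \<le> ql" "ql \<le> qu" "qu \<le> num_subs P"
    using assms(5,6) unfolding subs_def by auto
  have eff: "0 < eff_discharge P r" "0 < retention P r"
    using inst(3) unfolding parameters_ok_def by auto
  have demand: "demand P r q ?T \<le> ?net q + ?gen q + ?heat" if "q \<in> {ql..qu}" for q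
  proof -
    have q: "q \<in> subs P" using that bounds unfolding subs_def by simp
    have "demand P r q ?T \<le> used_var X r q ?T n + (\<Sum>a \<in> heat_techs P. \<Sum>t \<in> active P a ?T.
        heat_coeff P a r q t ?T n * transfer_var X a q t ?T n)"
      using feas(2) n T q unfolding demand_constr_def by blast
    also have "\<dots> \<le> used_var X r q ?T n + ?heat"
      using n T q
      by (intro add_left_mono sum_mono heat_transfer_bound[OF inst(3) feas(1,6)])
        (auto simp: periods_def)
    also have "used_var X r q ?T n \<le> purch_var X r q ?T n - charge_var X r q ?T n +
        discharge_var X r q ?T n + ?gen q"
      using feas(3) n T q unfolding supply_constr_def by blast
    finally show ?thesis
      using no_purchase[OF feas(1,7) assms(2,4) T q] by simp
  qed
  have "0 \<le> stored_var X r qu ?T n"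
    using feas(1) n T bounds unfolding nonneg_vars_def subs_def by simp
  moreover have "retention P r * pred_stored P X r ql ?T n \<le> retention P r * ?cap"
    using eff pred_stored_le_capacity[OF inst(1,2) feas(5) assms(4,5), of r]
    by (intro mult_left_mono) simp_all
  ultimately have "eff_discharge P r * (retention P r * pred_stored P X r ql ?T n - stored_var X r qu ?T n)
      \<le> eff_discharge P r * (retention P r * ?cap)"
    using eff(1) by (intro mult_left_mono) linarith+
  with net_discharge_bound[OF inst(3) feas(1,4) n T bounds, of r]
  have net: "(\<Sum>q = ql..qu. ?net q) \<le> eff_discharge P r * retention P r * ?cap"
    by (simp add: mult.assoc)
  have "(\<Sum>q = ql..qu. demand P r q ?T) \<le> (\<Sum>q = ql..qu. ?net q + ?gen q + ?heat)"
    by (intro sum_mono demand)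
  also have "\<dots> = (\<Sum>q = ql..qu. ?net q) + (\<Sum>q = ql..qu. ?gen q) + (\<Sum>q = ql..qu. ?heat)"
    by (simp only: sum.distrib)
  finally show ?thesis
    using net by linarith
qed

end
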